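(* Let $\rho\in\mathbb{R}^{3}$ be a Rodriguez parameters vector and let $Q=[q_{0},q^{\top}]^{\top}\in\mathbb{S}^{3}$ be a unit-quaternion vector, with $q_{0}\in\mathbb{R}$ and $q\in\mathbb{R}^{3}$, such that $\rho$ and $Q$ represent the same rotation matrix, i.e. $\mathcal{R}_{\rho}(\rho)=\mathcal{R}_{Q}(Q)$. Then, with the same choice of sign in the first two formulas, $$q_{0}=\pm\frac{1}{\sqrt{1+\Vert\rho\Vert^{2}}},\qquad q=\pm\frac{\rho}{\sqrt{1+\Vert\rho\Vert^{2}}},$$ and, for $q_{0}\neq0$, $$\rho=\frac{q}{q_{0}}.$$
   Context: $\mathbb{S}^{3}=\{Q\in\mathbb{R}^{4}:\Vert Q\Vert=1\}$, where $\Vert\cdot\Vert$ is the Euclidean norm on vectors. For $x=[x_1,x_2,x_3]^{\top}\in\mathbb{R}^{3}$, $[x]_{\times}=\begin{bmatrix} 0 & -x_3 & x_2 \\ x_3 & 0 & -x_1 \\ -x_2 & x_1 & 0 \end{bmatrix}$. The rotation matrix with Rodriguez parameters vector $\rho\in\mathbb{R}^{3}$ is $\mathcal{R}_{\rho}(\rho)=\frac{1}{1+\Vert\rho\Vert^{2}}\left((1-\Vert\rho\Vert^{2})\mathbf{I}_{3}+2\rho\rho^{\top}+2[\rho]_{\times}\right)$, and the rotation matrix represented by $Q=[q_0,q^\top]^\top\in\mathbb{S}^{3}$ is $\mathcal{R}_{Q}(Q)=(q_{0}^{2}-\Vert q\Vert^{2})\mathbf{I}_{3}+2qq^{\top}+2q_{0}[q]_{\times}$.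 *)

theory Defs
  imports "HOL-Analysis.Analysis"
begin

definition S3 :: "(real ^ 4) set" where
  "S3 = {Q. norm Q = 1}"

definition skew3 :: "real ^ 3 \<Rightarrow> real ^ 3 ^ 3" where
  "skew3 x = vector [vector [0, - x $ 3, x $ 2],
                     vector [x $ 3, 0, - x $ 1],
                     vector [- x $ 2, x $ 1, 0]]"

definition outer3 :: "real ^ 3 \<Rightarrow> real ^ 3 ^ 3" where
  "outer3 x = (columnvector x :: real ^ 1 ^ 3) ** (rowvector x :: real ^ 3 ^ 1)"

definition rot_rodriguez :: "real ^ 3 \<Rightarrow> real ^ 3 ^ 3" where
  "rot_rodriguez \<rho> =
     (1 / (1 + (norm \<rho>)\<^sup>2)) *\<^sub>R
       ((1 - (norm \<rho>)\<^sup>2) *\<^sub>R mat 1 + 2 *\<^sub>R outer3 \<rho> + 2 *\<^sub>R skew3 \<rho>)"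

(* The scalar part q_0 sits at index 1, so the vector part has indices 2, 3, 4;
   in the index type 4 the numeral 4 is equal to 0. *)
definition quat_vec :: "real \<Rightarrow> real ^ 3 \<Rightarrow> real ^ 4" where
  "quat_vec q\<^sub>0 q = vector [q\<^sub>0, q $ 1, q $ 2, q $ 3]"

definition quat_re :: "real ^ 4 \<Rightarrow> real" where
  "quat_re Q = Q $ 1"

definition quat_im :: "real ^ 4 \<Rightarrow> real ^ 3" where
  "quat_im Q = vector [Q $ 2, Q $ 3, Q $ 4]"

definition rot_quat :: "real ^ 4 \<Rightarrow> real ^ 3 ^ 3" where
  "rot_quat Q =
     ((quat_re Q)\<^sup>2 - (norm (quat_im Q))\<^sup>2) *\<^sub>R mat 1
       + 2 *\<^sub>R outer3 (quat_im Q) + (2 * quat_re Q) *\<^sub>R skew3 (quat_im Q)"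

end

theory Submission
  imports Defs
begin

text \<open>Both matrices have the form \<open>M = a I + 2 u u\<^sup>T + b [u]\<^sub>\<times>\<close>. The trace of \<open>M\<close> is
  \<open>3 a + 2 \<parallel>u\<parallel>\<^sup>2\<close> and its antisymmetric part is \<open>b [u]\<^sub>\<times>\<close>. Comparing traces and using
  \<open>\<parallel>Q\<parallel> = 1\<close> gives \<open>q\<^sub>0\<^sup>2 = 1 / (1 + \<parallel>\<rho>\<parallel>\<^sup>2)\<close>; in particular \<open>q\<^sub>0 \<noteq> 0\<close>. Comparing antisymmetric
  parts gives \<open>q\<^sub>0 q = \<rho> / (1 + \<parallel>\<rho>\<parallel>\<^sup>2) = q\<^sub>0\<^sup>2 \<rho>\<close>, hence \<open>q = q\<^sub>0 \<rho>\<close>.\<close>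

lemma norm_sq_3: "(norm x)\<^sup>2 = (x $ 1)\<^sup>2 + (x $ 2)\<^sup>2 + (x $ 3)\<^sup>2"
  for x :: "real ^ 3"
  by (simp add: norm_vec_def L2_set_def sum_3)

lemma outer3_nth [simp]: "outer3 x $ i $ j = x $ i * x $ j"
  by (simp add: outer3_def matrix_matrix_mult_def columnvector_def rowvector_def)

lemma trace_outer3: "trace (outer3 x) = (norm x)\<^sup>2"
  by (simp add: trace_def sum_3 norm_sq_3 flip: power2_eq_square)

lemma trace_skew3: "trace (skew3 x) = 0"
  by (simp add: trace_def sum_3 skew3_def)

lemma trace_scaleR: "trace (c *\<^sub>R A) = c * trace A"
  for A :: "real ^ 'n ^ 'n"
  by (simp add: trace_def sum_distrib_left)

lemma transpose_outer3: "transpose (outer3 x) = outer3 x"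
  by (simp add: transpose_def vec_eq_iff mult.commute)

lemma transpose_skew3: "transpose (skew3 x) = - skew3 x"
  by (simp add: transpose_def vec_eq_iff forall_3 skew3_def)

lemma skew3_scaleR: "skew3 (c *\<^sub>R x) = c *\<^sub>R skew3 x"
  by (simp add: vec_eq_iff forall_3 skew3_def)

lemma skew3_inject: "skew3 x = skew3 y \<longleftrightarrow> x = y"
  by (auto simp: vec_eq_iff forall_3 skew3_def)

lemma transpose_add: "transpose (A + B) = transpose A + transpose B"
  for A B :: "real ^ 'n ^ 'm"
  by (simp add: transpose_def vec_eq_iff)

lemma vector_4_nth [simp]:
  fixes w x y z :: "'a::zero"
  shows "(vector [w, x, y, z] :: 'a ^ 4) $ 1 = w"
    "(vector [w, x, y, z] :: 'a ^ 4) $ 2 = x"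
    "(vector [w, x, y, z] :: 'a ^ 4) $ 3 = y"
    "(vector [w, x, y, z] :: 'a ^ 4) $ 4 = z"
  unfolding vector_def by simp_all

lemma quat_re_quat_vec [simp]: "quat_re (quat_vec q\<^sub>0 q) = q\<^sub>0"
  by (simp add: quat_re_def quat_vec_def)

lemma quat_im_quat_vec [simp]: "quat_im (quat_vec q\<^sub>0 q) = q"
  by (simp add: vec_eq_iff forall_3 quat_im_def quat_vec_def)

lemma norm_sq_quat_vec: "(norm (quat_vec q\<^sub>0 q))\<^sup>2 = q\<^sub>0\<^sup>2 + (norm q)\<^sup>2"
proof -
  have "(norm (quat_vec q\<^sub>0 q))\<^sup>2 = q\<^sub>0\<^sup>2 + ((q $ 1)\<^sup>2 + (q $ 2)\<^sup>2 + (q $ 3)\<^sup>2)"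
    by (simp add: norm_vec_def L2_set_def sum_4 quat_vec_def)
  then show ?thesis by (simp add: norm_sq_3)
qed

text \<open>The bracket has trace \<open>3 * (1 - n) + 2 * n = 3 - n\<close> with
  \<open>n = (norm \<rho>)\<^sup>2\<close>; writing it as \<open>4 - (1 + n)\<close> isolates the
  reciprocal that is to be matched with \<open>q\<^sub>0\<^sup>2\<close>.\<close>

lemma trace_rot_rodriguez:
  "trace (rot_rodriguez \<rho>) = 4 / (1 + (norm \<rho>)\<^sup>2) - 1"
proof -
  have "1 + (norm \<rho>)\<^sup>2 \<noteq> 0"
    using zero_le_power2[of "norm \<rho>"] by linarith
  moreover have "trace (rot_rodriguez \<rho>) = (3 - (norm \<rho>)\<^sup>2) / (1 + (norm \<rho>)\<^sup>2)"
    unfolding rot_rodriguez_def trace_scaleR trace_add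
    by (simp add: trace_I trace_outer3 trace_skew3)
  ultimately show ?thesis
    by (simp add: field_simps)
qed

lemma trace_rot_quat: "trace (rot_quat Q) = 3 * (quat_re Q)\<^sup>2 - (norm (quat_im Q))\<^sup>2"
  by (simp add: rot_quat_def trace_add trace_scaleR trace_I trace_outer3 trace_skew3)

text \<open>The symmetric terms cancel and the skew term doubles. The scalar sits inside
  \<open>skew3\<close> so that \<open>skew3_inject\<close> can compare vectors.\<close>

lemma antisym_rot_rodriguez:
  "rot_rodriguez \<rho> - transpose (rot_rodriguez \<rho>) = 4 *\<^sub>R skew3 (\<rho> /\<^sub>R (1 + (norm \<rho>)\<^sup>2))"
  unfolding rot_rodriguez_def transpose_scalar transpose_add transpose_mat transpose_outer3
    transpose_skew3 skew3_scaleR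
  by (simp add: vec_eq_iff algebra_simps divide_inverse)

lemma antisym_rot_quat:
  "rot_quat Q - transpose (rot_quat Q) = 4 *\<^sub>R skew3 (quat_re Q *\<^sub>R quat_im Q)"
  unfolding rot_quat_def transpose_scalar transpose_add transpose_mat transpose_outer3
    transpose_skew3 skew3_scaleR
  by (simp add: vec_eq_iff)

theorem lemma7:
  fixes \<rho> q :: "real ^ 3" and q\<^sub>0 :: real and Q :: "real ^ 4"
  assumes "Q \<in> S3" and "Q = quat_vec q\<^sub>0 q"
    and "rot_rodriguez \<rho> = rot_quat Q"
  shows "((q\<^sub>0 = 1 / sqrt (1 + (norm \<rho>)\<^sup>2) \<and> q = \<rho> /\<^sub>R sqrt (1 + (norm \<rho>)\<^sup>2)) \<or>
          (q\<^sub>0 = - (1 / sqrt (1 + (norm \<rho>)\<^sup>2)) \<and> q = - (\<rho> /\<^sub>R sqrt (1 + (norm \<rho>)\<^sup>2)))) \<and>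
         (q\<^sub>0 \<noteq> 0 \<longrightarrow> \<rho> = q /\<^sub>R q\<^sub>0)"
proof -
  define s where "s = 1 + (norm \<rho>)\<^sup>2"
  have s: "s > 0"
    using zero_le_power2[of "norm \<rho>"] unfolding s_def by linarith
  have unit: "q\<^sub>0\<^sup>2 + (norm q)\<^sup>2 = 1"
    using assms(1,2) norm_sq_quat_vec[of q\<^sub>0 q] by (simp add: S3_def)
  have "4 / s - 1 = 3 * q\<^sub>0\<^sup>2 - (norm q)\<^sup>2"
    using trace_rot_rodriguez[of \<rho>] trace_rot_quat[of Q] assms(2,3) by (simp add: s_def)
  \<comment> \<open>Substituting \<open>(norm q)\<^sup>2 = 1 - q\<^sub>0\<^sup>2\<close> turns the
    right-hand side into \<open>4 * q\<^sub>0\<^sup>2 - 1\<close>.\<close>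
  with unit have q0_sq: "q\<^sub>0\<^sup>2 = 1 / s"
    by simp
  with s have q0: "q\<^sub>0 \<noteq> 0"
    by auto
  have "skew3 (\<rho> /\<^sub>R s) = skew3 (q\<^sub>0 *\<^sub>R q)"
    using antisym_rot_rodriguez[of \<rho>] antisym_rot_quat[of Q] assms(2,3) by (simp add: s_def)
  then have "q\<^sub>0 *\<^sub>R q = q\<^sub>0 *\<^sub>R (q\<^sub>0 *\<^sub>R \<rho>)"
    using q0_sq by (simp add: skew3_inject power2_eq_square divide_inverse)
  \<comment> \<open>Merging the nested scalings into \<open>q\<^sub>0 * q\<^sub>0\<close> would hide
    the common factor that is cancelled here.\<close>
  with q0 have q: "q = q\<^sub>0 *\<^sub>R \<rho>"
    by (simp del: scaleR_scaleR)
  have "q\<^sub>0\<^sup>2 = (1 / sqrt s)\<^sup>2"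
    using q0_sq s by (simp add: power_divide)
  then have "q\<^sub>0 = 1 / sqrt s \<or> q\<^sub>0 = - (1 / sqrt s)"
    by (simp only: power2_eq_iff)
  \<comment> \<open>Since \<open>q\<close> is \<open>q\<^sub>0\<close> times \<open>\<rho>\<close>,
    it inherits the sign chosen for \<open>q\<^sub>0\<close>; dividing by \<open>q\<^sub>0\<close>
    recovers \<open>\<rho>\<close>.\<close>
  with q q0 show ?thesis
    unfolding s_def by (auto simp: divide_inverse)
qed

end
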